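(* Let $d\ge 2$. Let $H_d$ be the graph on $2d+2$ vertices obtained from the complete bipartite graph $K_{d,d}$ by removing the $d$ edges of a perfect matching and adding two new vertices, one adjacent to all $d$ vertices of the first part and the other adjacent to all $d$ vertices of the second part. Then $H_d$ is a $d$-regular graph of diameter $3$ whose adjacency spectrum consists of $\pm d$ (once each) and $\pm1$ ($d$ times each), so its algebraic connectivity is $d-1$, which is the maximum possible for $d$-regular graphs of diameter $3$. Moreover, $H_d$ is, up to isomorphism, the unique $d$-regular graph of diameter $3$ with algebraic connectivity equal to $d-1$.
   Context: Graphs are finite, simple and connected. The algebraic connectivity is the second smallest eigenvalue (with multiplicity) of the Laplacian matrix; for a connected $d$-regular graph it is $d$ minus the second largest adjacency eigenvalue. *)

theory Defs
  imports
    "Jordan_Normal_Form.Char_Poly"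
    "Graph_Theory.Graph_Theory"
begin

text \<open>
  A finite simple graph is a \<^locale>\<open>pair_graph\<close>: a finite, loop-free digraph whose arcs are pairs
  of vertices and whose arc relation is symmetric, each edge being represented by its two
  orientations.
\<close>

definition regular :: "nat \<Rightarrow> 'a pair_pre_digraph \<Rightarrow> bool" where
  "regular d G \<longleftrightarrow> (\<forall>v \<in> pverts G. out_degree (with_proj G) v = d)"

text \<open>
  With unit weights, \<open>\<mu>\<close> is the number of arcs of a shortest walk (\<open>\<infinity>\<close> if there is none).
\<close>

definition distance :: "'a pair_pre_digraph \<Rightarrow> 'a \<Rightarrow> 'a \<Rightarrow> ereal" where
  "distance G = wf_digraph.\<mu> (with_proj G) (\<lambda>_. 1)"

definition diameter :: "'a pair_pre_digraph \<Rightarrow> ereal" where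
  "diameter G = (SUP u \<in> pverts G. SUP v \<in> pverts G. distance G u v)"


text \<open>
  Matrices are indexed by positions in an enumeration \<open>vs\<close> of the vertex set. The lemma
  \<open>char_poly_graph_mat\<close> shows that the choice of the enumeration does not affect the
  characteristic polynomial.
\<close>

definition vertex_list :: "'a pair_pre_digraph \<Rightarrow> 'a list" where
  "vertex_list G = (SOME vs. distinct vs \<and> set vs = pverts G)"

definition graph_mat :: "('a \<Rightarrow> 'a \<Rightarrow> real) \<Rightarrow> 'a list \<Rightarrow> real mat" where
  "graph_mat f vs = mat (length vs) (length vs) (\<lambda>(i, j). f (vs ! i) (vs ! j))"

definition adjacency :: "'a pair_pre_digraph \<Rightarrow> 'a \<Rightarrow> 'a \<Rightarrow> real" where
  "adjacency G u v = (if (u, v) \<in> parcs G then 1 else 0)"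

definition laplacian :: "'a pair_pre_digraph \<Rightarrow> 'a \<Rightarrow> 'a \<Rightarrow> real" where
  "laplacian G u v = (if u = v then real (out_degree (with_proj G) u) else 0) - adjacency G u v"

definition adjacency_matrix :: "'a pair_pre_digraph \<Rightarrow> real mat" where
  "adjacency_matrix G = graph_mat (adjacency G) (vertex_list G)"

definition laplacian_matrix :: "'a pair_pre_digraph \<Rightarrow> real mat" where
  "laplacian_matrix G = graph_mat (laplacian G) (vertex_list G)"

text \<open>
  The real eigenvalues with their algebraic multiplicities; for the real symmetric matrices
  considered here these are all the eigenvalues.
\<close>

definition eigenvalue_mset :: "real mat \<Rightarrow> real multiset" where
  "eigenvalue_mset A = proots (char_poly A)"

definition algebraic_connectivity :: "'a pair_pre_digraph \<Rightarrow> real" where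
  "algebraic_connectivity G = sorted_list_of_multiset (eigenvalue_mset (laplacian_matrix G)) ! 1"

lemma vertex_list:
  assumes "finite (pverts G)"
  shows "distinct (vertex_list G)" "set (vertex_list G) = pverts G"
  using someI_ex[of "\<lambda>vs. distinct vs \<and> set vs = pverts G"] finite_distinct_list[OF assms]
  unfolding vertex_list_def by blast+

lemma char_poly_graph_mat:
  assumes vs: "distinct vs" and ws: "distinct ws" and eq: "set vs = set ws"
  shows "char_poly (graph_mat f vs) = char_poly (graph_mat f ws)"
proof -
  let ?n = "length vs"
  have n: "length ws = ?n" using vs ws eq by (metis distinct_card)
  define P where "P xs ys = mat ?n ?n (\<lambda>(i, j). if xs ! i = ys ! j then 1 else (0::real))"
    for xs ys :: "'a list"
  have P[simp]: "P xs ys \<in> carrier_mat ?n ?n" for xs ys by (simp add: P_def)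
  have PA: "P xs ys * mat ?n ?n (\<lambda>(i, j). g (ys ! i) j) = mat ?n ?n (\<lambda>(i, j). g (xs ! i) j)"
    if "distinct ys" "set xs = set ys" "length xs = ?n" "length ys = ?n" for xs ys :: "'a list"
      and g :: "'a \<Rightarrow> nat \<Rightarrow> real"
  proof (rule eq_matI; simp add: P_def scalar_prod_def)
    fix i j assume i: "i < ?n" and j: "j < ?n"
    have "xs ! i \<in> set xs" using i that(3) by (intro nth_mem) simp
    then have "xs ! i \<in> set ys" using that(2) by simp
    then obtain k where "k < length ys" "ys ! k = xs ! i" unfolding in_set_conv_nth by blast
    then have k: "k < ?n" "ys ! k = xs ! i" using that(4) by simp_all
    have "(\<Sum>l = 0..<?n. (if xs ! i = ys ! l then 1 else 0) * g (ys ! l) j)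
      = (\<Sum>l = 0..<?n. if l = k then g (xs ! i) j else 0)"
      using k that by (intro sum.cong) (auto simp: nth_eq_iff_index_eq)
    also have "\<dots> = g (xs ! i) j" using k by simp
    finally show "(\<Sum>l = 0..<?n. (if xs ! i = ys ! l then 1 else 0) * g (ys ! l) j) = g (xs ! i) j" .
  qed
  have one: "P xs ys * P ys xs = 1\<^sub>m ?n"
    if "distinct xs" "distinct ys" "set xs = set ys" "length xs = ?n" "length ys = ?n"
    for xs ys :: "'a list"
  proof -
    have "P xs ys * P ys xs = P xs xs"
      using PA[OF that(2-5), of "\<lambda>u j. if u = xs ! j then 1 else 0"] by (simp add: P_def)
    also have "\<dots> = 1\<^sub>m ?n"
      using that by (intro eq_matI) (auto simp: P_def nth_eq_iff_index_eq)
    finally show ?thesis .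
  qed
  define C where "C = mat ?n ?n (\<lambda>(i, j). f (vs ! i) (ws ! j))"
  have 1: "P vs ws * graph_mat f ws = C"
    using PA[of ws vs "\<lambda>u j. f u (ws ! j)"] ws eq n by (simp add: graph_mat_def C_def)
  have "graph_mat f vs * P vs ws = C"
  proof (rule eq_matI; simp add: P_def scalar_prod_def graph_mat_def C_def)
    fix i j assume i: "i < ?n" and j: "j < ?n"
    then obtain k where k: "k < ?n" "vs ! k = ws ! j"
      using eq n by (metis in_set_conv_nth nth_mem)
    have "(\<Sum>l = 0..<?n. f (vs ! i) (vs ! l) * (if vs ! l = ws ! j then 1 else 0))
      = (\<Sum>l = 0..<?n. if l = k then f (vs ! i) (ws ! j) else 0)"
      using k vs by (intro sum.cong) (auto simp flip: k(2) simp: nth_eq_iff_index_eq)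
    also have "\<dots> = f (vs ! i) (ws ! j)" using k by simp
    finally show "(\<Sum>l = 0..<?n. f (vs ! i) (vs ! l) * (if vs ! l = ws ! j then 1 else 0))
      = f (vs ! i) (ws ! j)" .
  qed
  then have "P vs ws * graph_mat f ws * P ws vs = graph_mat f vs * (P vs ws * P ws vs)"
    using 1 by (subst assoc_mult_mat[symmetric, of _ ?n ?n _ ?n _ ?n]) (auto simp: graph_mat_def)
  also have "\<dots> = graph_mat f vs"
    using one[of vs ws] vs ws eq n by (simp add: graph_mat_def)
  finally have "similar_mat_wit (graph_mat f vs) (graph_mat f ws) (P vs ws) (P ws vs)"
    using one[of vs ws] one[of ws vs] vs ws eq n
    by (auto simp: similar_mat_wit_def Let_def graph_mat_def)
  then show ?thesis
    by (intro char_poly_similar) (auto simp: similar_mat_def)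
qed


datatype H_vertex = Part1 nat | Part2 nat | Apex1 | Apex2

text \<open>
  Deleting a perfect matching gives the same graph up to isomorphism whichever one is chosen;
  here the vertices with equal indices are matched.
\<close>

definition K_bip :: "nat \<Rightarrow> H_vertex pair_pre_digraph" where
  "K_bip d = \<lparr> pverts = Part1 ` {..<d} \<union> Part2 ` {..<d},
    parcs = Part1 ` {..<d} \<times> Part2 ` {..<d} \<union> Part2 ` {..<d} \<times> Part1 ` {..<d} \<rparr>"

definition matching_arcs :: "nat \<Rightarrow> H_vertex rel" where
  "matching_arcs d = (\<Union>i<d. {(Part1 i, Part2 i), (Part2 i, Part1 i)})"

definition apex_arcs :: "nat \<Rightarrow> H_vertex rel" where
  "apex_arcs d = (\<Union>i<d. {(Apex1, Part1 i), (Part1 i, Apex1), (Apex2, Part2 i), (Part2 i, Apex2)})"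

definition H_graph :: "nat \<Rightarrow> H_vertex pair_pre_digraph" where
  "H_graph d = \<lparr> pverts = pverts (K_bip d) \<union> {Apex1, Apex2},
    parcs = (parcs (K_bip d) - matching_arcs d) \<union> apex_arcs d \<rparr>"

lemma K_bip: "complete_bipartite_digraph d d (with_proj (K_bip d))"
  unfolding complete_bipartite_digraph_pair_def
proof (intro conjI exI)
  show "pverts (K_bip d) = Part1 ` {..<d} \<union> Part2 ` {..<d}"
    "parcs (K_bip d) = Part1 ` {..<d} \<times> Part2 ` {..<d} \<union> Part2 ` {..<d} \<times> Part1 ` {..<d}"
    by (simp_all add: K_bip_def)
qed (auto simp: K_bip_def card_image inj_on_def)

end

theory Submission
  imports Defs
begin

text \<open>
  The upper bound and the uniqueness come from a single test vector. Let \<open>u\<close> and \<open>v\<close> be vertices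
  of a \<open>d\<close>-regular graph at distance at least 3. Their closed neighbourhoods are disjoint, so the
  vector with value \<open>d\<close> at \<open>u\<close>, \<open>1\<close> on the neighbours of \<open>u\<close>, \<open>- 1\<close> on the neighbours of \<open>v\<close>, \<open>- d\<close> at \<open>v\<close>
  and \<open>0\<close> elsewhere is well defined and orthogonal to the constants. Call it \<open>g\<close>. It satisfies
  \<open>g x * (L g) x \<le> (d - 1) * (g x)\<^sup>2\<close> at \<^emph>\<open>every\<close> vertex \<open>x\<close> (\<open>laplacian_test_pointwise\<close>): a neighbour \<open>x\<close> of
  \<open>u\<close> contributes \<open>1 - d\<close> through the arc to \<open>u\<close> and at most \<open>2\<close> through each of its other \<open>d - 1\<close>
  arcs, with \<open>2\<close> attained only when the arc ends at a neighbour of \<open>v\<close>. Summation bounds the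
  Rayleigh quotient of \<open>g\<close>, hence the algebraic connectivity, by \<open>d - 1\<close>.

  In the case of equality no term can be strict. So every neighbour of \<open>u\<close> is adjacent only to \<open>u\<close>
  and to neighbours of \<open>v\<close>, and vice versa (\<open>extremal_nbrs\<close>); by connectedness there are no other
  vertices, each neighbour of \<open>u\<close> misses exactly one neighbour of \<open>v\<close>, and the missing edges form a
  perfect matching. This is \<open>H\<^sub>d\<close> (\<open>extremal_digraph_iso_H_graph\<close>).

  The bound of the second smallest eigenvalue by a Rayleigh quotient (\<open>algebraic_connectivity_le\<close>)
  is obtained without diagonalizing the Laplacian \<open>L\<close>. The infimum of the Rayleigh quotient of a
  symmetric matrix is an eigenvalue (\<open>symmetric_rayleigh_eigenvector\<close>). Applied to \<open>L\<close> plus a large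
  multiple of the all-ones matrix, this gives an eigenvector orthogonal to the constants; in a
  connected graph its eigenvalue is not \<open>0\<close>, so it and \<open>0\<close> are two distinct eigenvalues of \<open>L\<close> not
  exceeding the bound.

  For the spectrum of \<open>H\<^sub>d\<close>, note that \<open>H\<^sub>d\<close> is the complete bipartite graph with parts of size
  \<open>d + 1\<close> minus a perfect matching, the two new vertices being the additional matched pair. Its
  adjacency matrix therefore has zero diagonal blocks and off-diagonal blocks \<open>J - I\<close>, and a
  unitriangular change of basis makes it upper triangular (\<open>H_graph_triangularization\<close>).
\<close>

section \<open>Rayleigh quotients of real symmetric matrices\<close>

lemma scalar_prod_self_pos:
  fixes v :: "real vec"
  assumes "v \<in> carrier_vec n" "v \<noteq> 0\<^sub>v n"
  shows "v \<bullet> v > 0"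
  using conjugate_square_greater_0_vec[OF assms(1)] assms(2) by simp

lemma quadratic_form_bounded:
  fixes A :: "real mat"
  assumes A: "A \<in> carrier_mat n n"
  obtains K where "K > 0" "\<And>v. v \<in> carrier_vec n \<Longrightarrow> \<bar>v \<bullet> (A *\<^sub>v v)\<bar> \<le> K * (v \<bullet> v)"
proof
  let ?K = "\<Sum>i<n. \<Sum>j<n. \<bar>A $$ (i,j)\<bar>"
  show "?K + 1 > 0" by (intro add_nonneg_pos sum_nonneg) auto
  fix v :: "real vec" assume v: "v \<in> carrier_vec n"
  have sq: "v $ i * v $ i \<le> v \<bullet> v" if "i < n" for i
    unfolding scalar_prod_def using v that
    by (intro member_le_sum[of i _ "\<lambda>i. v $ i * v $ i"]) auto
  have prod: "\<bar>v $ i * v $ j\<bar> \<le> v \<bullet> v" if "i < n" "j < n" for i j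
  proof -
    have "2 * \<bar>v $ i * v $ j\<bar> \<le> v $ i * v $ i + v $ j * v $ j"
      using sum_squares_bound[of "\<bar>v $ i\<bar>" "\<bar>v $ j\<bar>"] by (simp add: abs_mult power2_eq_square)
    then show ?thesis using sq[OF that(1)] sq[OF that(2)] by simp
  qed
  have "v \<bullet> (A *\<^sub>v v) = (\<Sum>i<n. \<Sum>j<n. A $$ (i,j) * (v $ i * v $ j))"
    using A v by (auto simp: scalar_prod_def sum_distrib_left lessThan_atLeast0 intro!: sum.cong)
  also have "\<bar>\<dots>\<bar> \<le> (\<Sum>i<n. \<Sum>j<n. \<bar>A $$ (i,j) * (v $ i * v $ j)\<bar>)"
    by (rule order_trans[OF sum_abs sum_mono[OF sum_abs]])
  also have "\<dots> \<le> (\<Sum>i<n. \<Sum>j<n. \<bar>A $$ (i,j)\<bar> * (v \<bullet> v))"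
    using prod by (intro sum_mono) (auto simp: abs_mult intro!: mult_left_mono)
  also have "\<dots> = ?K * (v \<bullet> v)" by (simp add: sum_distrib_right)
  also have "\<dots> \<le> (?K + 1) * (v \<bullet> v)"
    by (simp add: distrib_right scalar_prod_def sum_nonneg)
  finally show "\<bar>v \<bullet> (A *\<^sub>v v)\<bar> \<le> (?K + 1) * (v \<bullet> v)" .
qed

text \<open>
  With \<open>N\<close> the inverse of \<open>M\<close>, evaluating the form at \<open>v - s N v\<close> gives
  \<open>0 \<le> v \<bullet> M v - 2 s (v \<bullet> v) + s\<^sup>2 (v \<bullet> N v)\<close>. The last form is at most \<open>K (v \<bullet> v)\<close> for some \<open>K > 0\<close>, and
  the choice \<open>s = 1 / K\<close> leaves the claim with constant \<open>1 / K\<close>.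
\<close>

lemma positive_semidefinite_regular_imp_coercive:
  fixes M :: "real mat"
  assumes M: "M \<in> carrier_mat n n" and sym: "transpose_mat M = M"
    and psd: "\<And>v. v \<in> carrier_vec n \<Longrightarrow> 0 \<le> v \<bullet> (M *\<^sub>v v)"
    and det: "det M \<noteq> 0"
  obtains e where "e > 0" "\<And>v. v \<in> carrier_vec n \<Longrightarrow> e * (v \<bullet> v) \<le> v \<bullet> (M *\<^sub>v v)"
proof -
  obtain N where N: "N \<in> carrier_mat n n" and MN: "M * N = 1\<^sub>m n"
    using det_non_zero_imp_unit[OF M det, of "()"] by (auto simp: Units_def ring_mat_def)
  obtain K where K: "K > 0" "\<And>v. v \<in> carrier_vec n \<Longrightarrow> \<bar>v \<bullet> (N *\<^sub>v v)\<bar> \<le> K * (v \<bullet> v)"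
    using quadratic_form_bounded[OF N] by blast
  show thesis
  proof
    show "1 / K > 0" using K by simp
    fix v :: "real vec" assume v: "v \<in> carrier_vec n"
    define x where "x = N *\<^sub>v v"
    have x: "x \<in> carrier_vec n" using N v by (simp add: x_def)
    have Mx: "M *\<^sub>v x = v"
      using M N v MN by (simp add: x_def flip: assoc_mult_mat_vec)
    have xMv: "x \<bullet> (M *\<^sub>v v) = v \<bullet> v"
    proof -
      have "x \<bullet> (M *\<^sub>v v) = (transpose_mat M *\<^sub>v x) \<bullet> v"
        using transpose_vec_mult_scalar[OF M v x] by simp
      then show ?thesis by (simp add: sym Mx)
    qed
    have Mv: "M *\<^sub>v v \<in> carrier_vec n" using M v by simp
    let ?y = "v - (1 / K) \<cdot>\<^sub>v x"
    have "M *\<^sub>v ?y = M *\<^sub>v v - (1 / K) \<cdot>\<^sub>v v"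
      using M v x by (simp add: mult_minus_distrib_mat_vec mult_mat_vec Mx)
    then have "?y \<bullet> (M *\<^sub>v ?y)
      = v \<bullet> (M *\<^sub>v v) - 1 / K * (v \<bullet> v) - 1 / K * (x \<bullet> (M *\<^sub>v v)) + 1 / K * (1 / K * (x \<bullet> v))"
      using v x Mv
      by (simp add: minus_scalar_prod_distrib[of _ n] scalar_prod_minus_distrib[of _ n] algebra_simps)
    moreover have "x \<bullet> v \<le> K * (v \<bullet> v)"
      using K(2)[OF v] comm_scalar_prod[OF v x] by (simp add: x_def)
    then have "1 / K * (1 / K * (x \<bullet> v)) \<le> 1 / K * (v \<bullet> v)"
      using K(1) by (intro mult_left_mono) (auto simp: field_simps)
    moreover have "0 \<le> ?y \<bullet> (M *\<^sub>v ?y)" using v x by (intro psd) simp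
    ultimately show "1 / K * (v \<bullet> v) \<le> v \<bullet> (M *\<^sub>v v)" by (simp add: xMv)
  qed
qed

text \<open>
  Let \<open>m\<close> be the infimum of the Rayleigh quotient. Then \<open>A - m I\<close> is positive semidefinite; were it
  nonsingular, it would be coercive, and \<open>m\<close> could be increased. Hence \<open>m\<close> is an eigenvalue. This
  replaces the usual compactness of the unit sphere by linear algebra.
\<close>

lemma symmetric_rayleigh_eigenvector:
  fixes A :: "real mat"
  assumes A: "A \<in> carrier_mat n n" and sym: "transpose_mat A = A"
    and w: "w \<in> carrier_vec n" "w \<noteq> 0\<^sub>v n" and wc: "w \<bullet> (A *\<^sub>v w) \<le> c * (w \<bullet> w)"
  obtains m v where "m \<le> c" "eigenvector A v m"
proof -
  define R where "R = (\<lambda>v. v \<bullet> (A *\<^sub>v v) / (v \<bullet> v)) ` {v \<in> carrier_vec n. v \<noteq> 0\<^sub>v n}"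
  define m where "m = Inf R"
  define M where "M = char_matrix A m"
  obtain K where K: "K > 0" "\<And>v. v \<in> carrier_vec n \<Longrightarrow> \<bar>v \<bullet> (A *\<^sub>v v)\<bar> \<le> K * (v \<bullet> v)"
    using quadratic_form_bounded[OF A] by blast
  have bdd: "bdd_below R"
    unfolding R_def
  proof (rule bdd_belowI2)
    fix v :: "real vec" assume "v \<in> {v \<in> carrier_vec n. v \<noteq> 0\<^sub>v n}"
    then show "- K \<le> v \<bullet> (A *\<^sub>v v) / (v \<bullet> v)"
      using K(2)[of v] scalar_prod_self_pos[of v n] by (simp add: field_simps abs_le_iff)
  qed
  have ne: "R \<noteq> {}" using w by (auto simp: R_def)
  have le: "m * (v \<bullet> v) \<le> v \<bullet> (A *\<^sub>v v)" if "v \<in> carrier_vec n" for v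
  proof (cases "v = 0\<^sub>v n")
    case True then show ?thesis using A by simp
  next
    case False
    then have "m \<le> v \<bullet> (A *\<^sub>v v) / (v \<bullet> v)"
      unfolding m_def using bdd that by (intro cInf_lower) (auto simp: R_def)
    then show ?thesis using scalar_prod_self_pos[OF that False] by (simp add: field_simps)
  qed
  have mc: "m \<le> c"
    using le[OF w(1)] wc scalar_prod_self_pos[OF w]
    by (meson mult_le_cancel_right order_trans not_less_iff_gr_or_eq)
  have M: "M \<in> carrier_mat n n" using A by (simp add: M_def)
  have symM: "transpose_mat M = M"
  proof (rule eq_matI)
    fix i j assume "i < dim_row M" "j < dim_col M"
    moreover then have "A $$ (j, i) = A $$ (i, j)"
      using A M arg_cong[OF sym, of "\<lambda>B. B $$ (i, j)"] by simp
    ultimately show "transpose_mat M $$ (i, j) = M $$ (i, j)"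
      using A M by (simp add: M_def char_matrix_def)
  qed (use M in auto)
  have Mv: "v \<bullet> (M *\<^sub>v v) = v \<bullet> (A *\<^sub>v v) - m * (v \<bullet> v)" if "v \<in> carrier_vec n" for v
  proof -
    have "M *\<^sub>v v = A *\<^sub>v v + (- m) \<cdot>\<^sub>v v"
      using A that by (auto simp: M_def char_matrix_def add_mult_distrib_mat_vec[of _ n n]
          intro!: eq_vecI)
    then show ?thesis using A that by (simp add: scalar_prod_add_distrib[of _ n])
  qed
  have "det M = 0"
  proof (rule ccontr)
    assume "det M \<noteq> 0"
    moreover have "0 \<le> v \<bullet> (M *\<^sub>v v)" if "v \<in> carrier_vec n" for v
      using le[OF that] Mv[OF that] by simp
    ultimately obtain e
      where e: "e > 0" "\<And>v. v \<in> carrier_vec n \<Longrightarrow> e * (v \<bullet> v) \<le> v \<bullet> (M *\<^sub>v v)"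
      using positive_semidefinite_regular_imp_coercive[OF M symM] by blast
    have "m + e \<le> Inf R"
    proof (rule cInf_greatest[OF ne])
      fix r assume "r \<in> R"
      then obtain v where v: "v \<in> carrier_vec n" "v \<noteq> 0\<^sub>v n" "r = v \<bullet> (A *\<^sub>v v) / (v \<bullet> v)"
        by (auto simp: R_def)
      have "(m + e) * (v \<bullet> v) \<le> v \<bullet> (A *\<^sub>v v)"
        using e(2)[OF v(1)] Mv[OF v(1)] by (simp add: algebra_simps)
      then show "m + e \<le> r"
        unfolding v(3) using scalar_prod_self_pos[OF v(1,2)] by (simp add: pos_le_divide_eq)
    qed
    then show False using e(1) by (simp add: m_def)
  qed
  then have "eigenvalue A m" using eigenvalue_det[OF A] by (simp add: M_def)
  then show thesis using that mc by (auto simp: eigenvalue_def)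
qed

section \<open>Kernels on a finite vertex set\<close>

lemma sorted_list_of_multiset_second_le:
  fixes a b c :: "'a :: linorder"
  assumes "a \<in># M" "b \<in># M" "a \<noteq> b" "a \<le> c" "b \<le> c"
  shows "sorted_list_of_multiset M ! 1 \<le> c"
proof -
  let ?xs = "sorted_list_of_multiset M"
  have "a \<in> set ?xs" "b \<in> set ?xs" using assms by simp_all
  then obtain i j where ij: "i < length ?xs" "?xs ! i = a" "j < length ?xs" "?xs ! j = b"
    by (metis in_set_conv_nth)
  then have "i \<noteq> j" using assms(3) by auto
  then have "1 \<le> max i j" by auto
  then have "?xs ! 1 \<le> ?xs ! max i j"
    using ij by (intro sorted_nth_mono) auto
  also have "\<dots> \<le> c" using ij assms by (auto simp: max_def)
  finally show ?thesis .
qed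

lemma graph_mat_carrier: "graph_mat f vs \<in> carrier_mat (length vs) (length vs)"
  by (simp add: graph_mat_def)

lemma sum_nth_distinct:
  assumes "distinct vs"
  shows "(\<Sum>i<length vs. h (vs ! i)) = sum h (set vs)"
  using sum.reindex_bij_betw[OF bij_betw_nth[OF assms refl refl], of h] by simp

lemma graph_mat_mult_vec:
  assumes "distinct vs"
  shows "graph_mat f vs *\<^sub>v vec (length vs) (\<lambda>i. g (vs ! i))
    = vec (length vs) (\<lambda>i. \<Sum>y\<in>set vs. f (vs ! i) y * g y)"
  using sum_nth_distinct[OF assms]
  by (intro eq_vecI) (auto simp: graph_mat_def scalar_prod_def lessThan_atLeast0)

lemma eigenfunction_in_eigenvalue_mset:
  assumes vs: "distinct vs" and g: "x \<in> set vs" "g x \<noteq> 0"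
    and eig: "\<And>x. x \<in> set vs \<Longrightarrow> (\<Sum>y\<in>set vs. f x y * g y) = m * g x"
  shows "m \<in># eigenvalue_mset (graph_mat f vs)"
proof -
  let ?A = "graph_mat f vs" and ?n = "length vs"
  let ?v = "vec ?n (\<lambda>i. g (vs ! i))"
  have A: "?A \<in> carrier_mat ?n ?n" by (rule graph_mat_carrier)
  obtain i where "i < ?n" "vs ! i = x" using g(1) by (auto simp: in_set_conv_nth)
  then have "?v $ i \<noteq> 0\<^sub>v ?n $ i" using g(2) by simp
  then have "?v \<noteq> 0\<^sub>v ?n" by metis
  moreover have "?A *\<^sub>v ?v = m \<cdot>\<^sub>v ?v"
    using eig by (auto simp: graph_mat_mult_vec[OF vs])
  ultimately have "eigenvector ?A ?v m" using A by (simp add: eigenvector_def)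
  then have "poly (char_poly ?A) m = 0"
    using eigenvalue_root_char_poly[OF A] by (auto simp: eigenvalue_def)
  moreover have "char_poly ?A \<noteq> 0" using degree_monic_char_poly[OF A] by auto
  ultimately show ?thesis by (simp add: eigenvalue_mset_def)
qed

text \<open>
  The existence of a small eigenvalue, transferred from vectors indexed by positions to functions
  on the vertex set.
\<close>

lemma symmetric_kernel_eigenfunction:
  fixes f :: "'a \<Rightarrow> 'a \<Rightarrow> real" and w :: "'a \<Rightarrow> real"
  assumes vs: "distinct vs" and sym: "\<And>x y. x \<in> set vs \<Longrightarrow> y \<in> set vs \<Longrightarrow> f x y = f y x"
    and w: "x \<in> set vs" "w x \<noteq> 0"
    and le: "(\<Sum>x\<in>set vs. w x * (\<Sum>y\<in>set vs. f x y * w y)) \<le> c * (\<Sum>x\<in>set vs. w x * w x)"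
  obtains m g x where "m \<le> c" "x \<in> set vs" "g x \<noteq> 0"
    "\<And>x. x \<in> set vs \<Longrightarrow> (\<Sum>y\<in>set vs. f x y * g y) = m * g x"
proof -
  let ?A = "graph_mat f vs" and ?n = "length vs"
  let ?w = "vec ?n (\<lambda>i. w (vs ! i))"
  have A: "?A \<in> carrier_mat ?n ?n" by (rule graph_mat_carrier)
  have "transpose_mat ?A = ?A" by (rule eq_matI) (auto simp: graph_mat_def sym)
  moreover obtain i where "i < ?n" "vs ! i = x" using w(1) by (auto simp: in_set_conv_nth)
  then have "?w $ i \<noteq> 0\<^sub>v ?n $ i" using w(2) by simp
  then have "?w \<noteq> 0\<^sub>v ?n" by metis
  moreover have "?w \<bullet> (?A *\<^sub>v ?w) \<le> c * (?w \<bullet> ?w)"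
    using le sum_nth_distinct[OF vs, of "\<lambda>x. w x * (\<Sum>y\<in>set vs. f x y * w y)"]
      sum_nth_distinct[OF vs, of "\<lambda>x. w x * w x"]
    by (simp add: graph_mat_mult_vec[OF vs] scalar_prod_def lessThan_atLeast0)
  ultimately obtain m v where m: "m \<le> c" and v: "eigenvector ?A v m"
    using symmetric_rayleigh_eigenvector[OF A _ vec_carrier] by metis
  have vc: "v \<in> carrier_vec ?n" "v \<noteq> 0\<^sub>v ?n" "?A *\<^sub>v v = m \<cdot>\<^sub>v v"
    using v A by (auto simp: eigenvector_def)
  define g where "g x = v $ the_inv_into {..<?n} ((!) vs) x" for x
  have "inj_on ((!) vs) {..<?n}" using vs by (intro inj_on_nth) auto
  then have g: "g (vs ! i) = v $ i" if "i < ?n" for i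
    using that by (simp add: g_def the_inv_into_f_f)
  have vg: "v = vec ?n (\<lambda>i. g (vs ! i))" using vc(1) g by (intro eq_vecI) auto
  obtain j where "j < ?n" "v $ j \<noteq> 0"
    using vc(1,2) by (metis carrier_vecD eq_vecI index_zero_vec)
  show thesis
  proof
    show "m \<le> c" by fact
    show "vs ! j \<in> set vs" "g (vs ! j) \<noteq> 0" using \<open>j < ?n\<close> \<open>v $ j \<noteq> 0\<close> g by auto
    fix y assume "y \<in> set vs"
    then obtain i where i: "i < ?n" "vs ! i = y" by (auto simp: in_set_conv_nth)
    have "(?A *\<^sub>v v) $ i = (\<Sum>z\<in>set vs. f (vs ! i) z * g z)"
      using i by (subst vg) (simp add: graph_mat_mult_vec[OF vs])
    moreover have "(?A *\<^sub>v v) $ i = m * v $ i" using vc i by simp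
    ultimately show "(\<Sum>z\<in>set vs. f y z * g z) = m * g y" using i g[OF i(1)] by simp
  qed
qed

section \<open>The Laplacian of a connected graph\<close>

abbreviation nbrs :: "'a pair_pre_digraph \<Rightarrow> 'a \<Rightarrow> 'a set" where
  "nbrs G x \<equiv> parcs G `` {x}"

lemma out_degree_eq_card_nbrs: "out_degree (with_proj G) x = card (nbrs G x)"
proof -
  have "out_arcs (with_proj G) x = Pair x ` nbrs G x" by (auto simp: out_arcs_def)
  then show ?thesis by (simp add: out_degree_def card_image inj_on_def)
qed

context pair_graph
begin

lemma nbrs_subset: "nbrs G x \<subseteq> pverts G"
  using in_arcsD2 by auto

lemma finite_nbrs: "finite (nbrs G x)"
  using nbrs_subset pair_finite_verts by (rule finite_subset)

lemma laplacian_sum: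
  assumes "x \<in> pverts G"
  shows "(\<Sum>y\<in>pverts G. laplacian G x y * g y) = (\<Sum>y\<in>nbrs G x. g x - g y)"
proof -
  have "(\<Sum>y\<in>pverts G. laplacian G x y * g y)
    = (\<Sum>y\<in>pverts G. if x = y then real (card (nbrs G x)) * g x else 0)
      - (\<Sum>y\<in>pverts G. if (x, y) \<in> parcs G then g y else 0)"
    unfolding sum_subtractf[symmetric]
    by (intro sum.cong) (auto simp: laplacian_def adjacency_def out_degree_eq_card_nbrs algebra_simps)
  also have "(\<Sum>y\<in>pverts G. if x = y then real (card (nbrs G x)) * g x else 0)
    = (\<Sum>y\<in>nbrs G x. g x)"
    using assms pair_finite_verts by simp
  also have "(\<Sum>y\<in>pverts G. if (x, y) \<in> parcs G then g y else 0) = (\<Sum>y\<in>nbrs G x. g y)"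
    using in_arcsD2 pair_finite_verts by (subst sum.inter_filter[symmetric]) (auto intro!: sum.cong)
  finally show ?thesis by (simp add: sum_subtractf)
qed

lemma laplacian_commute: "laplacian G x y = laplacian G y x"
  using arcs_symmetric by (auto simp: laplacian_def adjacency_def)

text \<open>
  Connectedness enters only through this principle: once for harmonic functions, and once to show
  that an extremal graph has no vertices beyond two closed neighbourhoods.
\<close>

lemma closed_set_contains_component:
  assumes conn: "connected (with_proj G)"
    and "x \<in> S" "x \<in> pverts G" and closed: "\<And>y. y \<in> S \<Longrightarrow> nbrs G y \<subseteq> S"
  shows "pverts G \<subseteq> S"
proof
  fix z assume z: "z \<in> pverts G"
  have "strongly_connected (with_proj G)"
    using conn by (intro symmetric_connected_imp_strongly_connected sym_arcs)
  then obtain p where "awalk x p z"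
    using z assms(3) by (auto simp: strongly_connected_def reachable_awalk)
  then show "z \<in> S" using \<open>x \<in> S\<close>
  proof (induction p arbitrary: x)
    case Nil then show ?case by (simp add: awalk_Nil_iff)
  next
    case (Cons e p)
    then have e: "e \<in> parcs G" "fst e = x" "awalk (snd e) p z" by (auto simp: awalk_Cons_iff)
    then have "snd e \<in> nbrs G x" by (cases e) auto
    then show ?case using Cons.IH[OF e(3)] closed[OF Cons.prems(2)] by blast
  qed
qed

text \<open>
  Maximum principle: where \<open>g\<close> is maximal all differences \<open>g x - g y\<close> to neighbours are nonnegative,
  and their sum is zero, so the set of maximum points is closed under adjacency.
\<close>

lemma harmonic_constant:
  fixes g :: "'a \<Rightarrow> real"
  assumes conn: "connected (with_proj G)"
    and harm: "\<And>x. x \<in> pverts G \<Longrightarrow> (\<Sum>y\<in>nbrs G x. g x - g y) = 0"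
  obtains k where "\<And>x. x \<in> pverts G \<Longrightarrow> g x = k"
proof (cases "pverts G = {}")
  case True then show ?thesis using that by simp
next
  case False
  let ?k = "Max (g ` pverts G)"
  have max: "g x \<le> ?k" if "x \<in> pverts G" for x using that pair_finite_verts by simp
  have "?k \<in> g ` pverts G" using False pair_finite_verts by (intro Max_in) auto
  then obtain z where z: "z \<in> pverts G" "g z = ?k" by auto
  have "pverts G \<subseteq> {x \<in> pverts G. g x = ?k}"
  proof (rule closed_set_contains_component[OF conn])
    show "z \<in> {x \<in> pverts G. g x = ?k}" "z \<in> pverts G" using z by auto
    fix x assume x: "x \<in> {x \<in> pverts G. g x = ?k}"
    have "g x - g y = 0" if "y \<in> nbrs G x" for y
    proof (rule sum_nonneg_0[OF finite_nbrs _ _ that])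
      show "(\<Sum>y\<in>nbrs G x. g x - g y) = 0" using harm x by blast
    qed (use x max[OF in_arcsD2] in auto)
    then show "nbrs G x \<subseteq> {x \<in> pverts G. g x = ?k}" using x nbrs_subset by force
  qed
  then show ?thesis using that by blast
qed

text \<open>
  The shift by \<open>t\<close> in every entry does not change the quotient of \<open>w\<close>, since \<open>w\<close> sums to zero, but
  raises the eigenvalue \<open>0\<close> of the constants above \<open>c\<close>. An eigenfunction of the shifted kernel for an
  eigenvalue \<open>m \<le> c\<close> is thus orthogonal to the constants, hence one of the Laplacian itself.
\<close>

lemma algebraic_connectivity_le:
  fixes w :: "'a \<Rightarrow> real"
  assumes conn: "connected (with_proj G)"
    and w: "x0 \<in> pverts G" "w x0 \<noteq> 0" "sum w (pverts G) = 0"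
    and le: "(\<Sum>x\<in>pverts G. w x * (\<Sum>y\<in>nbrs G x. w x - w y)) \<le> c * (\<Sum>x\<in>pverts G. w x * w x)"
    and c: "0 \<le> c"
  shows "algebraic_connectivity G \<le> c"
proof -
  let ?V = "pverts G" and ?vs = "vertex_list G"
  define t where "t = (c + 1) / card ?V"
  have n: "card ?V > 0" using w(1) pair_finite_verts by (auto simp: card_gt_0_iff)
  note vs = vertex_list[OF pair_finite_verts]
  have shift: "(\<Sum>y\<in>?V. (laplacian G x y + t) * g y) = (\<Sum>y\<in>nbrs G x. g x - g y) + t * sum g ?V"
    if "x \<in> ?V" for g x
    using laplacian_sum[OF that, of g] by (simp add: distrib_right sum.distrib sum_distrib_left)
  let ?f = "\<lambda>x y. laplacian G x y + t"
  have sym: "?f x y = ?f y x" for x y by (simp add: laplacian_commute[of x y])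
  have le': "(\<Sum>x\<in>?V. w x * (\<Sum>y\<in>?V. ?f x y * w y)) \<le> c * (\<Sum>x\<in>?V. w x * w x)"
    using le by (simp add: shift w(3))
  obtain m g x1 where m: "m \<le> c" and x1: "x1 \<in> ?V" "g x1 \<noteq> 0"
    and g: "\<And>x. x \<in> ?V \<Longrightarrow> (\<Sum>y\<in>?V. ?f x y * g y) = m * g x"
    by (rule symmetric_kernel_eigenfunction[OF vs(1), unfolded vs(2), OF sym w(1,2) le']) blast
  have col: "(\<Sum>x\<in>?V. laplacian G x y) = 0" if "y \<in> ?V" for y
    using laplacian_sum[OF that, of "\<lambda>_. 1"] by (simp add: laplacian_commute[of _ y])
  \<comment> \<open>Every column of the shifted kernel sums to \<open>t * card V = c + 1\<close>, which exceeds \<open>m\<close>.\<close>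
  have "m * sum g ?V = (\<Sum>x\<in>?V. \<Sum>y\<in>?V. (laplacian G x y + t) * g y)"
    by (simp add: g sum_distrib_left)
  also have "\<dots> = (\<Sum>y\<in>?V. \<Sum>x\<in>?V. (laplacian G x y + t) * g y)" by (rule sum.swap)
  also have "\<dots> = (\<Sum>y\<in>?V. (c + 1) * g y)"
    using n by (intro sum.cong) (auto simp: sum.distrib col t_def simp flip: sum_distrib_right)
  also have "\<dots> = (c + 1) * sum g ?V" by (simp add: sum_distrib_left)
  finally have "(c + 1 - m) * sum g ?V = 0" by (simp add: algebra_simps)
  then have sum0: "sum g ?V = 0" using m by simp
  have eig: "(\<Sum>y\<in>nbrs G x. g x - g y) = m * g x" if "x \<in> ?V" for x
    using g[OF that] shift[OF that, of g] sum0 by simp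
  have "m \<noteq> 0"
  proof
    assume "m = 0"
    then obtain k where k: "\<And>x. x \<in> ?V \<Longrightarrow> g x = k"
      using harmonic_constant[OF conn, of g] eig by auto
    then have "real (card ?V) * k = 0" using sum0 by simp
    then show False using n k x1 by simp
  qed
  moreover have "m \<in># eigenvalue_mset (laplacian_matrix G)" "0 \<in># eigenvalue_mset (laplacian_matrix G)"
    unfolding laplacian_matrix_def
    by (rule eigenfunction_in_eigenvalue_mset[OF vs(1), unfolded vs(2), of x1 g];
        use x1 eig laplacian_sum[of _ g] in simp)
      (rule eigenfunction_in_eigenvalue_mset[OF vs(1), unfolded vs(2), of x1 "\<lambda>_. 1"];
        use x1 laplacian_sum[of _ "\<lambda>_. 1"] in simp)
  ultimately show ?thesis
    unfolding algebraic_connectivity_def using m c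
    by (intro sorted_list_of_multiset_second_le[of 0 _ m]) auto
qed

end

section \<open>Distance\<close>

context pair_graph
begin

lemma distance_le_length:
  assumes "awalk u p v" "length p \<le> k"
  shows "distance G u v \<le> ereal (real k)"
proof -
  have "distance G u v \<le> ereal (real (length p))"
    using min_cost_le_walk_cost[OF assms(1), of "\<lambda>_. 1"]
    by (simp add: distance_def awalk_cost_def sum_list_triv)
  also have "\<dots> \<le> ereal (real k)" using assms(2) by simp
  finally show ?thesis .
qed

lemma distance_le_two:
  assumes "u \<in> pverts G" "v \<in> pverts G"
    and "u = v \<or> (u, v) \<in> parcs G \<or> (\<exists>x. (u, x) \<in> parcs G \<and> (x, v) \<in> parcs G)"
  shows "distance G u v \<le> 2"
proof -
  obtain p where "awalk u p v" "length p \<le> 2"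
  proof -
    consider "u = v" | "(u, v) \<in> parcs G" | x where "(u, x) \<in> parcs G" "(x, v) \<in> parcs G"
      using assms(3) by blast
    then show thesis
    proof cases
      case 1 then show thesis using that[of "[]"] assms by (simp add: awalk_Nil_iff)
    next
      case 2 then show thesis using that[of "[(u, v)]"] assms by (simp add: awalk_simps)
    next
      case 3 then show thesis
        using that[of "[(u, x), (x, v)]"] assms in_arcsD2 by (simp add: awalk_simps)
    qed
  qed
  then show ?thesis using distance_le_length[of u p v 2] by simp
qed

lemma diameter_gt_two_obtains:
  assumes "diameter G > 2"
  obtains u v where "u \<in> pverts G" "v \<in> pverts G" "u \<noteq> v" "(u, v) \<notin> parcs G" "nbrs G u \<inter> nbrs G v = {}"
proof -
  obtain u v where uv: "u \<in> pverts G" "v \<in> pverts G" "2 < distance G u v"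
    using assms by (auto simp: diameter_def less_SUP_iff)
  then have "\<not> (u = v \<or> (u, v) \<in> parcs G \<or> (\<exists>x. (u, x) \<in> parcs G \<and> (x, v) \<in> parcs G))"
    using distance_le_two[OF uv(1,2)] by (meson not_le)
  moreover then have "nbrs G u \<inter> nbrs G v = {}" using arcs_symmetric by blast
  ultimately show ?thesis using that uv(1,2) by blast
qed

lemma three_le_distance:
  assumes "u \<noteq> v" "(u, v) \<notin> parcs G" "nbrs G u \<inter> nbrs G v = {}"
  shows "3 \<le> distance G u v"
  unfolding distance_def \<mu>_def
proof (rule INF_greatest)
  fix p assume "p \<in> {p. awalk u p v}"
  then have p: "awalk u p v" by simp
  have "\<not> length p < 3"
  proof
    assume "length p < 3"
    then consider "p = []" | e where "p = [e]" | e f where "p = [e, f]"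
      by (cases p rule: remdups_adj.cases) auto
    then show False
    proof cases
      case 1 then show ?thesis using p assms by (simp add: awalk_Nil_iff)
    next
      case 2 then show ?thesis using p assms by (cases e) (auto simp: awalk_simps)
    next
      case 3 then show ?thesis
        using p assms arcs_symmetric by (cases e; cases f) (auto simp: awalk_simps)
    qed
  qed
  then have "3 \<le> real (length p)" by linarith
  then show "3 \<le> ereal (awalk_cost (\<lambda>_. 1) p)"
    by (simp add: awalk_cost_def sum_list_triv)
qed

end

section \<open>The test vector of two remote vertices\<close>

text \<open>
  The hypotheses on \<open>u\<close> and \<open>v\<close> say that their distance is at least 3. They are symmetric in \<open>u\<close> and
  \<open>v\<close>, so every statement about the neighbours of \<open>u\<close> has a mirror image, obtained by interpreting
  the locale with \<open>u\<close> and \<open>v\<close> exchanged.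
\<close>

locale regular_remote_pair = pair_graph G for G :: "'a pair_pre_digraph" +
  fixes d :: nat and u v :: 'a
  assumes regular: "regular d G" and d: "d \<ge> 2"
    and u: "u \<in> pverts G" and v: "v \<in> pverts G" and neq: "u \<noteq> v"
    and nadj: "(u, v) \<notin> parcs G" and disj: "nbrs G u \<inter> nbrs G v = {}"
begin

lemma card_nbrs: "x \<in> pverts G \<Longrightarrow> card (nbrs G x) = d"
  using regular by (simp add: regular_def out_degree_eq_card_nbrs)

text \<open>
  On \<open>H\<^sub>d\<close> this is an eigenvector of the Laplacian for the eigenvalue \<open>d - 1\<close>. Written with
  indicators, it visibly changes sign when \<open>u\<close> and \<open>v\<close> are exchanged.
\<close>

definition test_vector :: "'a \<Rightarrow> real" where
  "test_vector x = real d * of_bool (x = u) - real d * of_bool (x = v)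
    + of_bool (x \<in> nbrs G u) - of_bool (x \<in> nbrs G v)"

lemma test_vector_values:
  "test_vector u = d" "test_vector v = - d" "x \<in> nbrs G u \<Longrightarrow> test_vector x = 1" "x \<in> nbrs G v \<Longrightarrow> test_vector x = - 1"
  "x \<notin> {u, v} \<union> nbrs G u \<union> nbrs G v \<Longrightarrow> test_vector x = 0"
proof -
  have "(v, u) \<notin> parcs G" "\<And>x. (x, x) \<notin> parcs G"
    using nadj arcs_symmetric no_loops' by blast+
  moreover have "\<not> ((u, y) \<in> parcs G \<and> (v, y) \<in> parcs G)" for y using disj by blast
  ultimately show "test_vector u = d" "test_vector v = - d" "x \<in> nbrs G u \<Longrightarrow> test_vector x = 1" "x \<in> nbrs G v \<Longrightarrow> test_vector x = - 1"
    "x \<notin> {u, v} \<union> nbrs G u \<union> nbrs G v \<Longrightarrow> test_vector x = 0"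
    using neq nadj by (auto simp: test_vector_def)
qed

lemma sum_test_vector: "sum test_vector (pverts G) = 0"
proof -
  have "(\<Sum>x\<in>pverts G. of_bool (x \<in> nbrs G y) :: real) = real d" if "y \<in> pverts G" for y
  proof -
    have "pverts G \<inter> {x. x \<in> nbrs G y} = nbrs G y" using nbrs_subset[of y] by blast
    then show ?thesis
      using card_nbrs[OF that] pair_finite_verts by (simp add: of_bool_def sum.If_cases)
  qed
  then show ?thesis
    using u v pair_finite_verts
    by (simp add: test_vector_def sum.distrib sum_subtractf of_bool_def flip: sum_distrib_left)
qed

text \<open>
  The arc from \<open>x\<close> to \<open>u\<close> contributes \<open>1 - d\<close>. As \<open>x\<close> is not adjacent to \<open>v\<close>, the only vertex where the
  test vector is below \<open>- 1\<close>, each of the other \<open>d - 1\<close> arcs contributes at most \<open>2\<close>, and less than \<open>2\<close> unless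
  it ends at a neighbour of \<open>v\<close>.
\<close>

lemma laplacian_test_near:
  assumes x: "x \<in> nbrs G u"
  shows "(\<Sum>y\<in>nbrs G x. test_vector x - test_vector y) \<le> real d - 1"
    and "\<not> nbrs G x \<subseteq> insert u (nbrs G v) \<Longrightarrow> (\<Sum>y\<in>nbrs G x. test_vector x - test_vector y) < real d - 1"
proof -
  have ux: "u \<in> nbrs G x" and xV: "x \<in> pverts G" using x arcs_symmetric in_arcsD2 by auto
  let ?B = "nbrs G x - {u}"
  have vx: "v \<notin> nbrs G x" using x disj arcs_symmetric by blast
  then have two: "1 - test_vector y \<le> 2" if "y \<in> ?B" for y
  proof -
    have "y \<noteq> u" "y \<noteq> v" using that vx by auto
    then show ?thesis using test_vector_values(3-5)[of y] by (cases "y \<in> nbrs G u"; cases "y \<in> nbrs G v") auto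
  qed
  have B: "finite ?B" "card ?B = d - 1" using finite_nbrs card_nbrs[OF xV] ux by auto
  have sumB: "(\<Sum>y\<in>?B. 2) = 2 * (real d - 1)" using B d by simp
  have split: "(\<Sum>y\<in>nbrs G x. test_vector x - test_vector y) = (1 - real d) + (\<Sum>y\<in>?B. 1 - test_vector y)"
    using ux finite_nbrs[of x] test_vector_values(1) test_vector_values(3)[OF x] by (simp add: sum.remove)
  show "(\<Sum>y\<in>nbrs G x. test_vector x - test_vector y) \<le> real d - 1"
    using sum_mono[of ?B "\<lambda>y. 1 - test_vector y" "\<lambda>_. 2"] two sumB d unfolding split by simp
  assume "\<not> nbrs G x \<subseteq> insert u (nbrs G v)"
  then obtain y where y: "y \<in> ?B" "y \<notin> nbrs G v" by auto
  then have "y \<noteq> u" "y \<noteq> v" using vx by auto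
  then have "1 - test_vector y < 2"
    using y(2) test_vector_values(3,5)[of y] by (cases "y \<in> nbrs G u") auto
  then have "(\<Sum>y\<in>?B. 1 - test_vector y) < (\<Sum>y\<in>?B. 2)"
    using y two B(1) by (intro sum_strict_mono_ex1) auto
  then show "(\<Sum>y\<in>nbrs G x. test_vector x - test_vector y) < real d - 1" using sumB d unfolding split by simp
qed

lemma laplacian_test_centre: "(\<Sum>y\<in>nbrs G u. test_vector u - test_vector y) = (real d - 1) * test_vector u"
  using test_vector_values(1,3) card_nbrs[OF u] by (simp add: algebra_simps)

lemma swap: "regular_remote_pair G d v u"
  using regular d u v neq nadj disj arcs_symmetric by unfold_locales auto

lemma swap_test_vector: "regular_remote_pair.test_vector G d v u x = - test_vector x"
  by (simp add: test_vector_def regular_remote_pair.test_vector_def[OF swap] algebra_simps)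

lemma laplacian_test_pointwise:
  shows "test_vector x * (\<Sum>y\<in>nbrs G x. test_vector x - test_vector y) \<le> (real d - 1) * (test_vector x * test_vector x)"
    and "x \<in> nbrs G u \<Longrightarrow> \<not> nbrs G x \<subseteq> insert u (nbrs G v) \<Longrightarrow>
      test_vector x * (\<Sum>y\<in>nbrs G x. test_vector x - test_vector y) < (real d - 1) * (test_vector x * test_vector x)"
proof -
  interpret s: regular_remote_pair G d v u by (rule swap)
  have neg: "(\<Sum>y\<in>nbrs G x. s.test_vector x - s.test_vector y) = - (\<Sum>y\<in>nbrs G x. test_vector x - test_vector y)" for x
    by (simp add: swap_test_vector sum_subtractf)
  consider "x = u" | "x = v" | "x \<in> nbrs G u" | "x \<in> nbrs G v" | "x \<notin> {u, v} \<union> nbrs G u \<union> nbrs G v"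
    by blast
  then show "test_vector x * (\<Sum>y\<in>nbrs G x. test_vector x - test_vector y) \<le> (real d - 1) * (test_vector x * test_vector x)"
  proof cases
    case 1 then show ?thesis using laplacian_test_centre by simp
  next
    case 2 then show ?thesis using s.laplacian_test_centre[unfolded neg, unfolded swap_test_vector] by simp
  next
    case 3 then show ?thesis using laplacian_test_near(1)[OF 3] test_vector_values(3)[OF 3] by simp
  next
    case 4 then show ?thesis using s.laplacian_test_near(1)[OF 4, unfolded neg] test_vector_values(4)[OF 4] by simp
  next
    case 5 then show ?thesis using test_vector_values(5)[OF 5] by simp
  qed
  show "test_vector x * (\<Sum>y\<in>nbrs G x. test_vector x - test_vector y) < (real d - 1) * (test_vector x * test_vector x)"
    if "x \<in> nbrs G u" "\<not> nbrs G x \<subseteq> insert u (nbrs G v)"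
    using laplacian_test_near(2)[OF that] test_vector_values(3)[OF that(1)] by simp
qed

lemma algebraic_connectivity_le_degree:
  assumes conn: "connected (with_proj G)"
  shows "algebraic_connectivity G \<le> real d - 1"
proof (rule algebraic_connectivity_le[OF conn u _ sum_test_vector])
  show "test_vector u \<noteq> 0" using d test_vector_values(1) by simp
  show "(\<Sum>x\<in>pverts G. test_vector x * (\<Sum>y\<in>nbrs G x. test_vector x - test_vector y)) \<le> (real d - 1) * (\<Sum>x\<in>pverts G. test_vector x * test_vector x)"
    unfolding sum_distrib_left by (intro sum_mono) (simp add: laplacian_test_pointwise flip: sum_distrib_left)
qed (use d in simp)

text \<open>
  A single strict inequality at \<open>x\<close> makes the Rayleigh quotient of the test vector strictly smaller
  than \<open>d - 1\<close>, and with it the algebraic connectivity.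
\<close>

lemma extremal_nbrs:
  assumes conn: "connected (with_proj G)" and eq: "algebraic_connectivity G = real d - 1"
    and x: "x \<in> nbrs G u"
  shows "nbrs G x \<subseteq> insert u (nbrs G v)"
proof (rule ccontr)
  assume not: "\<not> nbrs G x \<subseteq> insert u (nbrs G v)"
  let ?q = "\<Sum>x\<in>pverts G. test_vector x * (\<Sum>y\<in>nbrs G x. test_vector x - test_vector y)" and ?r = "\<Sum>x\<in>pverts G. test_vector x * test_vector x"
  have xV: "x \<in> pverts G" using x in_arcsD2 by auto
  have "?q < (\<Sum>x\<in>pverts G. (real d - 1) * (test_vector x * test_vector x))"
    using laplacian_test_pointwise xV x not pair_finite_verts by (intro sum_strict_mono_ex1) blast+
  then have q: "?q < (real d - 1) * ?r" by (simp add: sum_distrib_left)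
  have r: "?r > 0"
    using u test_vector_values(1) d pair_finite_verts by (intro sum_pos2[of _ u]) auto
  \<comment> \<open>The maximum with \<open>0\<close> supplies the nonnegativity required by the Rayleigh bound.\<close>
  let ?c = "max 0 (?q / ?r)"
  have "algebraic_connectivity G \<le> ?c"
  proof (rule algebraic_connectivity_le[OF conn u _ sum_test_vector])
    show "test_vector u \<noteq> 0" using d test_vector_values(1) by simp
    have "?q = ?q / ?r * ?r" using r by simp
    also have "\<dots> \<le> ?c * ?r" using r by (intro mult_right_mono) auto
    finally show "?q \<le> ?c * ?r" .
  qed simp
  also have "?c < real d - 1" using q r d by (simp add: pos_divide_less_eq)
  finally show False using eq by simp
qed

end

lemma (in pair_graph) diameter_three_remote_pair:
  assumes "regular d G" "diameter G = 3" "d \<ge> 2"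
  obtains u v where "regular_remote_pair G d u v"
proof -
  have "diameter G > 2" using assms(2) by simp
  then obtain u v where "u \<in> pverts G" "v \<in> pverts G" "u \<noteq> v" "(u, v) \<notin> parcs G" "nbrs G u \<inter> nbrs G v = {}"
    by (rule diameter_gt_two_obtains)
  then have "regular_remote_pair G d u v" using assms by unfold_locales
  then show thesis by (rule that)
qed

section \<open>The graph \<open>H\<^sub>d\<close>\<close>

lemma pverts_H_graph: "pverts (H_graph d) = Part1 ` {..<d} \<union> Part2 ` {..<d} \<union> {Apex1, Apex2}"
  by (simp add: H_graph_def K_bip_def)

lemma nbrs_H_graph:
  "nbrs (H_graph d) Apex1 = Part1 ` {..<d}"
  "nbrs (H_graph d) Apex2 = Part2 ` {..<d}"
  "i < d \<Longrightarrow> nbrs (H_graph d) (Part1 i) = insert Apex1 (Part2 ` ({..<d} - {i}))"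
  "i < d \<Longrightarrow> nbrs (H_graph d) (Part2 i) = insert Apex2 (Part1 ` ({..<d} - {i}))"
  by (auto simp: H_graph_def K_bip_def matching_arcs_def apex_arcs_def)

lemma parcs_H_graph_subset: "parcs (H_graph d) \<subseteq> pverts (H_graph d) \<times> pverts (H_graph d)"
  by (auto simp: H_graph_def K_bip_def matching_arcs_def apex_arcs_def)

lemma pair_graph_H_graph: "pair_graph (H_graph d)"
proof
  show "e \<in> parcs (H_graph d) \<Longrightarrow> fst e \<in> pverts (H_graph d)"
    "e \<in> parcs (H_graph d) \<Longrightarrow> snd e \<in> pverts (H_graph d)" for e
    using parcs_H_graph_subset[of d] by auto
  show fin: "finite (pverts (H_graph d))" by (simp add: pverts_H_graph)
  show "finite (parcs (H_graph d))"
    by (rule finite_subset[OF parcs_H_graph_subset]) (simp add: fin)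
  show "e \<in> parcs (H_graph d) \<Longrightarrow> fst e \<noteq> snd e" for e
    by (auto simp: H_graph_def K_bip_def matching_arcs_def apex_arcs_def)
  show "symmetric (with_proj (H_graph d))"
    by (auto simp: symmetric_def sym_def H_graph_def K_bip_def matching_arcs_def apex_arcs_def)
qed

lemma regular_H_graph: "regular d (H_graph d)"
  unfolding regular_def pverts_H_graph
proof
  fix x assume "x \<in> Part1 ` {..<d} \<union> Part2 ` {..<d} \<union> {Apex1, Apex2}"
  then show "out_degree (with_proj (H_graph d)) x = d"
    by (elim UnE imageE insertE emptyE)
      (auto simp: out_degree_eq_card_nbrs nbrs_H_graph card_image inj_on_def card_insert_if
        simp del: Image_singleton)
qed

text \<open>
  Opposite vertices \<open>Part1 i\<close> and \<open>Part2 i\<close> are joined through \<open>Part2 k\<close> and \<open>Apex2\<close> for some \<open>k \<noteq> i\<close>;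
  this is where \<open>d \<ge> 2\<close> is needed.
\<close>

lemma H_graph_short_awalk:
  assumes d: "d \<ge> 2" and xy: "x \<in> pverts (H_graph d)" "y \<in> pverts (H_graph d)"
  obtains p where "pre_digraph.awalk (with_proj (H_graph d)) x p y" "length p \<le> 3"
proof -
  interpret pair_graph "H_graph d" by (rule pair_graph_H_graph)
  let ?R = "parcs (H_graph d)"
  have apex: "(Apex1, Part1 i) \<in> ?R" "(Part1 i, Apex1) \<in> ?R" "(Apex2, Part2 i) \<in> ?R" "(Part2 i, Apex2) \<in> ?R"
    if "i < d" for i
    using that by (auto simp: H_graph_def K_bip_def matching_arcs_def apex_arcs_def)
  have part: "(Part1 i, Part2 j) \<in> ?R" "(Part2 j, Part1 i) \<in> ?R" if "i < d" "j < d" "i \<noteq> j" for i j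
    using that by (auto simp: H_graph_def K_bip_def matching_arcs_def apex_arcs_def)
  have other: "\<exists>k<d. k \<noteq> i" for i
    using d by (intro exI[of _ "if i = 0 then 1 else 0"]) auto
  have "x = y \<or> (x, y) \<in> ?R \<or> (\<exists>a. (x, a) \<in> ?R \<and> (a, y) \<in> ?R) \<or>
    (\<exists>a b. (x, a) \<in> ?R \<and> (a, b) \<in> ?R \<and> (b, y) \<in> ?R)"
    using xy unfolding pverts_H_graph
    by (elim UnE imageE insertE emptyE; hypsubst; metis apex part other lessThan_iff)
  then show thesis
  proof (elim disjE exE conjE)
    assume "x = y" then show thesis using that[of "[]"] xy by (simp add: awalk_Nil_iff)
  next
    assume "(x, y) \<in> ?R" then show thesis using that[of "[(x, y)]"] xy by (simp add: awalk_simps)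
  next
    fix a assume "(x, a) \<in> ?R" "(a, y) \<in> ?R"
    then show thesis using that[of "[(x, a), (a, y)]"] xy in_arcsD2 by (simp add: awalk_simps)
  next
    fix a b assume "(x, a) \<in> ?R" "(a, b) \<in> ?R" "(b, y) \<in> ?R"
    then show thesis
      using that[of "[(x, a), (a, b), (b, y)]"] xy in_arcsD2 by (simp add: awalk_simps)
  qed
qed

lemma connected_H_graph:
  assumes "d \<ge> 2"
  shows "connected (with_proj (H_graph d))"
proof -
  interpret pair_graph "H_graph d" by (rule pair_graph_H_graph)
  show ?thesis
  proof (rule connectedI)
    show "pverts (H_graph d) \<noteq> {}" by (simp add: pverts_H_graph)
    fix x y assume "x \<in> pverts (H_graph d)" "y \<in> pverts (H_graph d)"
    then have "x \<rightarrow>\<^sup>*\<^bsub>with_proj (H_graph d)\<^esub> y"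
      using H_graph_short_awalk[OF assms, of x y] reachable_awalk by metis
    then show "x \<rightarrow>\<^sup>*\<^bsub>mk_symmetric (with_proj (H_graph d))\<^esub> y" by (rule reachable_mk_symmetricI)
  qed
qed

lemma diameter_H_graph:
  assumes "d \<ge> 2"
  shows "diameter (H_graph d) = 3"
proof (rule antisym)
  interpret pair_graph "H_graph d" by (rule pair_graph_H_graph)
  have "distance (H_graph d) x y \<le> 3"
    if "x \<in> pverts (H_graph d)" "y \<in> pverts (H_graph d)" for x y
    using H_graph_short_awalk[OF assms that] distance_le_length[of x _ y 3] by force
  then show "diameter (H_graph d) \<le> 3" unfolding diameter_def by (intro SUP_least)
  have "3 \<le> distance (H_graph d) Apex1 Apex2"
  proof (rule three_le_distance)
    have "Apex2 \<notin> nbrs (H_graph d) Apex1" unfolding nbrs_H_graph by auto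
    then show "(Apex1, Apex2) \<notin> parcs (H_graph d)" by simp
    show "nbrs (H_graph d) Apex1 \<inter> nbrs (H_graph d) Apex2 = {}" unfolding nbrs_H_graph by auto
  qed simp
  also have "\<dots> \<le> (SUP y \<in> pverts (H_graph d). distance (H_graph d) Apex1 y)"
    by (rule SUP_upper) (simp add: pverts_H_graph)
  also have "\<dots> \<le> diameter (H_graph d)"
    unfolding diameter_def
    by (rule SUP_upper[of Apex1 _ "\<lambda>x. SUP y \<in> pverts (H_graph d). distance (H_graph d) x y"])
      (simp add: pverts_H_graph)
  finally show "3 \<le> diameter (H_graph d)" .
qed

section \<open>The spectrum of \<open>H\<^sub>d\<close>\<close>

text \<open>
  The affine form treats the adjacency matrix \<open>A\<close> (\<open>c = 0\<close>, \<open>s = 1\<close>) and the Laplacian matrix of a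
  regular graph (\<open>c = d\<close>, \<open>s = - 1\<close>) at once.
\<close>

lemma char_poly_affine_triangularized:
  fixes A :: "'a :: field mat"
  assumes A: "A \<in> carrier_mat n n" and P: "P \<in> carrier_mat n n" and T: "T \<in> carrier_mat n n"
    and det: "det P \<noteq> 0" and AP: "A * P = P * T" and ut: "upper_triangular T"
  shows "char_poly (c \<cdot>\<^sub>m 1\<^sub>m n + s \<cdot>\<^sub>m A) = (\<Prod>i\<leftarrow>[0..<n]. [:- (c + s * T $$ (i, i)), 1:])"
proof -
  obtain Q where Q: "Q \<in> carrier_mat n n" and PQ: "P * Q = 1\<^sub>m n" and QP: "Q * P = 1\<^sub>m n"
    using det_non_zero_imp_unit[OF P det, of "()"] by (auto simp: Units_def ring_mat_def)
  let ?A = "c \<cdot>\<^sub>m 1\<^sub>m n + s \<cdot>\<^sub>m A" and ?T = "c \<cdot>\<^sub>m 1\<^sub>m n + s \<cdot>\<^sub>m T"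
  have carr: "?A \<in> carrier_mat n n" "?T \<in> carrier_mat n n" using A T by auto
  have "?A * P = c \<cdot>\<^sub>m P + s \<cdot>\<^sub>m (P * T)"
    using A P by (simp add: add_mult_distrib_mat[of _ n n] mult_smult_assoc_mat[of _ n n _ n] AP)
  also have "\<dots> = P * ?T"
    using P T mult_add_distrib_mat[OF P, of "c \<cdot>\<^sub>m 1\<^sub>m n" n "s \<cdot>\<^sub>m T"]
    by (simp add: mult_smult_distrib[of _ n n _ n])
  finally have AP': "?A * P = P * ?T" .
  have "P * ?T * Q = ?A * (P * Q)"
    unfolding AP'[symmetric] using carr P Q by (simp add: assoc_mult_mat[of _ n n _ n _ n])
  also have "\<dots> = ?A" by (simp only: PQ right_mult_one_mat[OF carr(1)])
  finally have "similar_mat_wit ?A ?T P Q"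
    using A carr P Q PQ QP by (auto simp: similar_mat_wit_def Let_def)
  then have "char_poly ?A = char_poly ?T" by (intro char_poly_similar) (auto simp: similar_mat_def)
  also have "\<dots> = (\<Prod>a\<leftarrow>diag_mat ?T. [:- a, 1:])"
    using carr ut T by (intro char_poly_upper_triangular[of _ n]) (auto simp: upper_triangular_def)
  also have "diag_mat ?T = map (\<lambda>i. c + s * T $$ (i, i)) [0..<n]"
    using T by (auto simp: diag_mat_def)
  finally show ?thesis by (simp add: o_def)
qed

lemma proots_prod_linear_factors:
  "proots (\<Prod>i\<leftarrow>xs. [:- f i, 1:]) = mset (map f xs)" for f :: "'b \<Rightarrow> 'a :: idom"
proof (induction xs)
  case (Cons a xs)
  have "(\<Prod>i\<leftarrow>xs. [:- f i, 1:]) \<noteq> 0" by (auto simp: prod_list_zero_iff)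
  then show ?case using Cons by (simp add: proots_mult del: mult_pCons_left)
qed simp

text \<open>
  An enumeration that exhibits \<open>H\<^sub>d\<close> as a complete bipartite graph with parts of size \<open>d + 1\<close> minus a
  perfect matching: the parts are the positions below and from \<open>d + 1\<close> on, and the nonadjacent pairs across are
  \<open>i\<close> and \<open>i + d + 1\<close>, the two apexes forming the pair with \<open>i = 0\<close>.
\<close>

definition H_vertex_at :: "nat \<Rightarrow> nat \<Rightarrow> H_vertex" where
  "H_vertex_at d i = (if i = 0 then Apex1 else if i \<le> d then Part2 (i - 1)
     else if i = Suc d then Apex2 else Part1 (i - d - 2))"

lemma bij_betw_H_vertex_at:
  "bij_betw (H_vertex_at d) {0..<2 * Suc d} (pverts (H_graph d))"
proof -
  have "inj_on (H_vertex_at d) {0..<2 * Suc d}"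
    by (auto simp: inj_on_def H_vertex_at_def split: if_splits)
  moreover have "Part2 i = H_vertex_at d (Suc i)" "Part1 i = H_vertex_at d (i + d + 2)" if "i < d" for i
    using that by (simp_all add: H_vertex_at_def)
  moreover have "Apex1 = H_vertex_at d 0" "Apex2 = H_vertex_at d (Suc d)"
    by (simp_all add: H_vertex_at_def)
  ultimately have "pverts (H_graph d) \<subseteq> H_vertex_at d ` {0..<2 * Suc d}"
    unfolding pverts_H_graph by auto
  moreover have "H_vertex_at d ` {0..<2 * Suc d} \<subseteq> pverts (H_graph d)"
    unfolding pverts_H_graph by (auto simp: H_vertex_at_def)
  ultimately show ?thesis
    using \<open>inj_on (H_vertex_at d) {0..<2 * Suc d}\<close> by (auto simp: bij_betw_def)
qed

lemma adjacency_H_vertex_at: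
  assumes "i < 2 * Suc d" "j < 2 * Suc d"
  shows "adjacency (H_graph d) (H_vertex_at d i) (H_vertex_at d j)
    = (if i < Suc d \<and> Suc d \<le> j \<and> j \<noteq> i + Suc d \<or> j < Suc d \<and> Suc d \<le> i \<and> i \<noteq> j + Suc d then 1 else 0)"
  using assms
  by (auto simp: adjacency_def H_vertex_at_def H_graph_def K_bip_def matching_arcs_def apex_arcs_def)

text \<open>
  Here \<open>A\<close> has blocks \<open>0\<close> and \<open>B = J - I\<close>. The basis consisting of the all-ones vector and the unit
  vectors other than the first, the columns of \<open>M\<close>, makes \<open>B\<close> upper triangular: \<open>B M = M S\<close>. The
  shear with blocks \<open>I, 0; I, I\<close> turns \<open>A\<close> into the block upper triangular matrix \<open>B, B; 0, - B\<close>, and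
  \<open>P\<close> combines both changes of basis.
\<close>

lemma H_graph_triangularization:
  fixes n :: nat
  defines "A \<equiv> mat (2 * n) (2 * n) (\<lambda>(i, j).
      if i < n \<and> n \<le> j \<and> j \<noteq> i + n \<or> j < n \<and> n \<le> i \<and> i \<noteq> j + n then 1 else 0 :: real)"
  assumes n: "n > 0"
  obtains P T where "P \<in> carrier_mat (2 * n) (2 * n)" "T \<in> carrier_mat (2 * n) (2 * n)"
    "det P \<noteq> 0" "A * P = P * T" "upper_triangular T"
    "\<And>i. i < 2 * n \<Longrightarrow> T $$ (i, i) = (if i = 0 then real n - 1 else if i < n then - 1 else
       if i = n then 1 - real n else 1)"
proof -
  define B where "B = mat n n (\<lambda>(i, j). if i = j then 0 else 1 :: real)"
  define M where "M = mat n n (\<lambda>(i, j). if i = j \<or> j = 0 then 1 else 0 :: real)"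
  define S where "S = mat n n (\<lambda>(i, j).
    if i = 0 then (if j = 0 then real n - 1 else 1) else if i = j then - 1 else 0)"
  define P where "P = four_block_mat M (0\<^sub>m n n) M M"
  define T where "T = four_block_mat S S (0\<^sub>m n n) (- S)"
  have carr: "B \<in> carrier_mat n n" "M \<in> carrier_mat n n" "S \<in> carrier_mat n n" "- S \<in> carrier_mat n n"
    by (simp_all add: B_def M_def S_def)
  have BM: "B * M = M * S"
  proof (rule eq_matI)
    fix i j assume "i < dim_row (M * S)" "j < dim_col (M * S)"
    then have ij: "i < n" "j < n" by (simp_all add: M_def S_def)
    have "(B * M) $$ (i, j) = (\<Sum>k<n. (if k = i then 0 else 1) * (if k = j \<or> j = 0 then 1 else 0))"
      using ij by (auto simp: B_def M_def scalar_prod_def lessThan_atLeast0 intro!: sum.cong)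
    also have "\<dots> = (\<Sum>k<n. (if k = j \<or> j = 0 then 1 else 0) - (if k = i then (if k = j \<or> j = 0 then 1 else 0) else 0))"
      by (intro sum.cong) auto
    also have "\<dots> = (if j = 0 then real n - 1 else if i = j then 0 else 1)"
      using ij by (simp add: sum_subtractf)
    also have "\<dots> = S $$ (0, j) + (if i = 0 then 0 else S $$ (i, j))"
      using ij by (auto simp: S_def)
    also have "\<dots> = (\<Sum>k<n. (if k = 0 then S $$ (k, j) else 0) + (if k = i then (if i = 0 then 0 else S $$ (k, j)) else 0))"
      using ij by (simp add: sum.distrib)
    also have "\<dots> = (\<Sum>k<n. (if i = k \<or> k = 0 then 1 else 0) * S $$ (k, j))"
      by (intro sum.cong) auto
    also have "\<dots> = (M * S) $$ (i, j)"
      using ij by (auto simp: M_def S_def scalar_prod_def lessThan_atLeast0 intro!: sum.cong)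
    finally show "(B * M) $$ (i, j) = (M * S) $$ (i, j)" .
  qed (simp_all add: B_def M_def S_def)
  have A: "A = four_block_mat (0\<^sub>m n n) B B (0\<^sub>m n n)"
    by (rule eq_matI) (auto simp: A_def B_def)
  have "A * P = four_block_mat (B * M) (B * M) (B * M) (0\<^sub>m n n)"
    unfolding A P_def using carr
    by (subst mult_four_block_mat[where ?n1.0 = n and ?n2.0 = n]) auto
  also have "\<dots> = P * T"
  proof -
    have "M * S + - (M * S) = 0\<^sub>m n n" by (rule eq_matI) (use carr in auto)
    then show ?thesis
      unfolding T_def P_def using carr
      by (subst mult_four_block_mat[where ?n1.0 = n and ?n2.0 = n]) (auto simp: BM)
  qed
  finally have AP: "A * P = P * T" .
  have P: "P \<in> carrier_mat (2 * n) (2 * n)" and T: "T \<in> carrier_mat (2 * n) (2 * n)"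
    using carr by (auto simp: P_def T_def mult_2)
  have "det P = prod_list (diag_mat P)"
    using carr by (intro det_lower_triangular[OF _ P]) (auto simp: P_def M_def)
  also have "diag_mat P = replicate (2 * n) 1"
    using P by (intro nth_equalityI) (auto simp: diag_mat_def P_def M_def)
  finally have "det P \<noteq> 0" by simp
  moreover have "upper_triangular T"
    by (rule upper_triangularI) (auto simp: T_def S_def)
  moreover have "T $$ (i, i) = (if i = 0 then real n - 1 else if i < n then - 1 else
       if i = n then 1 - real n else 1)" if "i < 2 * n" for i
    using that n by (auto simp: T_def S_def)
  ultimately show thesis using that P T AP by blast
qed

lemma eigenvalue_mset_H_graph_affine:
  fixes c s :: real
  assumes f: "\<And>x y. f x y = (if x = y then c else 0) + s * adjacency (H_graph d) x y"
  shows "eigenvalue_mset (graph_mat f (vertex_list (H_graph d))) =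
    {# c + s * d, c - s * d #} + replicate_mset d (c + s) + replicate_mset d (c - s)"
proof -
  let ?n = "Suc d" and ?vs = "map (H_vertex_at d) [0..<2 * Suc d]"
  define A where "A = mat (2 * ?n) (2 * ?n) (\<lambda>(i, j).
      if i < ?n \<and> ?n \<le> j \<and> j \<noteq> i + ?n \<or> j < ?n \<and> ?n \<le> i \<and> i \<noteq> j + ?n then 1 else 0 :: real)"
  obtain P T where PT: "P \<in> carrier_mat (2 * ?n) (2 * ?n)" "T \<in> carrier_mat (2 * ?n) (2 * ?n)"
    "det P \<noteq> 0" "A * P = P * T" "upper_triangular T"
    and diag: "\<And>i. i < 2 * ?n \<Longrightarrow> T $$ (i, i) = (if i = 0 then real ?n - 1 else if i < ?n then - 1 else
       if i = ?n then 1 - real ?n else 1)"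
    unfolding A_def by (rule H_graph_triangularization[of ?n]) auto
  have A: "A \<in> carrier_mat (2 * ?n) (2 * ?n)" by (simp add: A_def)
  have inj: "H_vertex_at d i = H_vertex_at d j \<longleftrightarrow> i = j" if "i < 2 * ?n" "j < 2 * ?n" for i j
    using that bij_betw_H_vertex_at[of d] by (auto simp: bij_betw_def inj_on_def)
  have "graph_mat f ?vs = c \<cdot>\<^sub>m 1\<^sub>m (2 * ?n) + s \<cdot>\<^sub>m A"
  proof (rule eq_matI)
    fix i j assume "i < dim_row (c \<cdot>\<^sub>m 1\<^sub>m (2 * ?n) + s \<cdot>\<^sub>m A)" "j < dim_col (c \<cdot>\<^sub>m 1\<^sub>m (2 * ?n) + s \<cdot>\<^sub>m A)"
    then have ij: "i < 2 * ?n" "j < 2 * ?n" using A by simp_all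
    then have "graph_mat f ?vs $$ (i, j) = f (H_vertex_at d i) (H_vertex_at d j)"
      by (simp add: graph_mat_def del: upt_Suc mult_Suc_right)
    then show "graph_mat f ?vs $$ (i, j) = (c \<cdot>\<^sub>m 1\<^sub>m (2 * ?n) + s \<cdot>\<^sub>m A) $$ (i, j)"
      using ij inj[OF ij] adjacency_H_vertex_at[OF ij]
      by (simp add: f A_def del: mult_Suc_right)
  qed (simp_all add: graph_mat_def A_def)
  moreover have "char_poly (graph_mat f (vertex_list (H_graph d))) = char_poly (graph_mat f ?vs)"
    using vertex_list[of "H_graph d"] bij_betw_H_vertex_at[of d]
    by (intro char_poly_graph_mat)
      (auto simp: bij_betw_def distinct_map pverts_H_graph simp del: upt_Suc mult_Suc_right)
  ultimately have "eigenvalue_mset (graph_mat f (vertex_list (H_graph d)))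
    = mset (map (\<lambda>i. c + s * T $$ (i, i)) [0..<2 * ?n])"
    unfolding eigenvalue_mset_def
    by (simp only: char_poly_affine_triangularized[OF A PT] proots_prod_linear_factors)
  also have "[0..<2 * ?n] = 0 # [1..<?n] @ ?n # [Suc ?n..<2 * ?n]"
    using upt_conv_Cons[of 0 "2 * ?n"] upt_conv_Cons[of ?n "2 * ?n"]
      upt_add_eq_append[of 1 ?n "?n"] by (simp add: mult_2)
  also have "mset (map (\<lambda>i. c + s * T $$ (i, i)) \<dots>) =
    {# c + s * d, c - s * d #} + mset (map (\<lambda>i. c - s) [1..<?n]) + mset (map (\<lambda>i. c + s) [Suc ?n..<2 * ?n])"
  proof -
    have "map (\<lambda>i. c + s * T $$ (i, i)) [1..<?n] = map (\<lambda>i. c - s) [1..<?n]"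
      "map (\<lambda>i. c + s * T $$ (i, i)) [Suc ?n..<2 * ?n] = map (\<lambda>i. c + s) [Suc ?n..<2 * ?n]"
      by (auto simp: diag)
    moreover have "c + s * T $$ (0, 0) = c + s * d" "c + s * T $$ (?n, ?n) = c - s * d"
      by (simp_all add: diag)
    ultimately show ?thesis by (simp only: list.map map_append) (simp del: upt_Suc mult_Suc_right)
  qed
  also have "\<dots> = {# c + s * d, c - s * d #} + replicate_mset d (c + s) + replicate_mset d (c - s)"
    by (simp add: map_replicate_const mset_replicate del: upt_Suc)
  finally show ?thesis .
qed


lemma card_pverts_H_graph: "card (pverts (H_graph d)) = 2 * d + 2"
  using bij_betw_same_card[OF bij_betw_H_vertex_at[of d]] by simp

lemma eigenvalue_mset_adjacency_H_graph:
  "eigenvalue_mset (adjacency_matrix (H_graph d)) =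
    {# real d, - real d #} + replicate_mset d 1 + replicate_mset d (- 1)"
  using eigenvalue_mset_H_graph_affine[of "adjacency (H_graph d)" 0 1 d]
  by (simp add: adjacency_matrix_def)

lemma eigenvalue_mset_laplacian_H_graph:
  "eigenvalue_mset (laplacian_matrix (H_graph d)) =
    {# 0, 2 * real d #} + replicate_mset d (real d - 1) + replicate_mset d (real d + 1)"
proof -
  interpret pair_graph "H_graph d" by (rule pair_graph_H_graph)
  define f where "f x y = (if x = y then real d else 0) + (- 1) * adjacency (H_graph d) x y" for x y
  have "laplacian (H_graph d) x y = f x y" if "x \<in> pverts (H_graph d)" for x y
    using that regular_H_graph[of d] by (cases "x = y") (auto simp: f_def laplacian_def regular_def)
  then have "laplacian_matrix (H_graph d) = graph_mat f (vertex_list (H_graph d))"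
    unfolding laplacian_matrix_def graph_mat_def
    using vertex_list(2)[OF pair_finite_verts] by (intro eq_matI) (auto dest: nth_mem)
  then show ?thesis
    using eigenvalue_mset_H_graph_affine[of f "real d" "- 1" d] by (simp add: f_def)
qed

lemma algebraic_connectivity_H_graph:
  assumes "d \<ge> 2"
  shows "algebraic_connectivity (H_graph d) = real d - 1"
proof -
  let ?xs = "0 # replicate d (real d - 1) @ replicate d (real d + 1) @ [2 * real d]"
  have "sorted ?xs" using assms by (auto simp: sorted_append)
  moreover have "mset ?xs = eigenvalue_mset (laplacian_matrix (H_graph d))"
    by (simp add: eigenvalue_mset_laplacian_H_graph)
  ultimately have "sorted_list_of_multiset (eigenvalue_mset (laplacian_matrix (H_graph d))) = ?xs"
    by (metis sorted_list_of_multiset_mset sorted_sort_id)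
  moreover have "?xs ! 1 = real d - 1" using assms by (simp add: nth_append)
  ultimately show ?thesis by (simp add: algebraic_connectivity_def)
qed

section \<open>The extremal graphs\<close>

lemma (in pair_wf_digraph) digraph_isoI_nbrs:
  assumes bij: "bij_betw \<phi> (pverts G) (pverts H)"
    and H: "parcs H \<subseteq> pverts H \<times> pverts H"
    and nbrs: "\<And>x. x \<in> pverts G \<Longrightarrow> nbrs H (\<phi> x) = \<phi> ` nbrs G x"
  shows "digraph_iso (with_proj G) (with_proj H)"
proof -
  let ?hom = "\<lparr>iso_verts = \<phi>, iso_arcs = map_prod \<phi> \<phi>, iso_head = snd, iso_tail = fst\<rparr>"
  have inj: "inj_on \<phi> (pverts G)" and img: "\<phi> ` pverts G = pverts H"
    using bij by (auto simp: bij_betw_def)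
  have sub: "parcs G \<subseteq> pverts G \<times> pverts G" using in_arcsD1 in_arcsD2 by auto
  have "map_prod \<phi> \<phi> ` parcs G = parcs H"
  proof (intro subset_antisym subsetI)
    fix e assume "e \<in> map_prod \<phi> \<phi> ` parcs G"
    then obtain x y where xy: "(x, y) \<in> parcs G" "e = (\<phi> x, \<phi> y)" by auto
    then have "\<phi> y \<in> nbrs H (\<phi> x)" using nbrs[OF in_arcsD1[OF xy(1)]] by blast
    then show "e \<in> parcs H" using xy by simp
  next
    fix e assume e: "e \<in> parcs H"
    then obtain x z where x: "x \<in> pverts G" "e = (\<phi> x, z)" using H img by force
    then have "z \<in> \<phi> ` nbrs G x" using nbrs[OF x(1)] e by blast
    then show "e \<in> map_prod \<phi> \<phi> ` parcs G" using x by force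
  qed
  then have "with_proj H = app_iso ?hom (with_proj G)"
    using img by (simp add: app_iso_def with_proj_def)
  moreover have "inj_on (map_prod \<phi> \<phi>) (parcs G)"
    using map_prod_inj_on[OF inj inj] sub by (rule inj_on_subset)
  then have "pre_digraph.digraph_isomorphism (with_proj G) ?hom"
    using inj wf_digraph by (simp add: digraph_isomorphism_def)
  ultimately show ?thesis unfolding digraph_iso_def by blast
qed

context regular_remote_pair
begin

lemma extremal_pverts:
  assumes conn: "connected (with_proj G)" and eq: "algebraic_connectivity G = real d - 1"
  shows "pverts G = {u, v} \<union> nbrs G u \<union> nbrs G v"
proof
  interpret s: regular_remote_pair G d v u by (rule swap)
  show "{u, v} \<union> nbrs G u \<union> nbrs G v \<subseteq> pverts G" using u v in_arcsD2 by auto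
  show "pverts G \<subseteq> {u, v} \<union> nbrs G u \<union> nbrs G v"
    using extremal_nbrs[OF conn eq] s.extremal_nbrs[OF conn eq]
    by (intro closed_set_contains_component[OF conn _ u]) blast+
qed

text \<open>
  By regularity \<open>x\<close> has \<open>d - 1\<close> neighbours besides \<open>u\<close>, all among the \<open>d\<close> neighbours of \<open>v\<close>.
\<close>

lemma extremal_missing_nbr:
  assumes conn: "connected (with_proj G)" and eq: "algebraic_connectivity G = real d - 1"
    and x: "x \<in> nbrs G u"
  shows "\<exists>y\<in>nbrs G v. nbrs G x = insert u (nbrs G v - {y})"
proof -
  have sub: "nbrs G x - {u} \<subseteq> nbrs G v" using extremal_nbrs[OF conn eq x] by blast
  have ux: "u \<in> nbrs G x" and xV: "x \<in> pverts G" using x arcs_symmetric in_arcsD2 by auto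
  have "card (nbrs G v - (nbrs G x - {u})) = card (nbrs G v) - card (nbrs G x - {u})"
    using sub finite_nbrs by (intro card_Diff_subset) auto
  also have "\<dots> = 1" using card_nbrs[OF v] card_nbrs[OF xV] ux d by simp
  finally obtain y where "nbrs G v - (nbrs G x - {u}) = {y}" by (auto simp: card_1_singleton_iff)
  then have "y \<in> nbrs G v" "nbrs G x - {u} = nbrs G v - {y}" using sub by auto
  then show ?thesis using ux by blast
qed

text \<open>
  The map \<open>m\<close> sends a neighbour of \<open>u\<close> to the neighbour of \<open>v\<close> that it misses. It is injective: a
  neighbour of \<open>v\<close> missed twice would have at most \<open>d - 2\<close> neighbours besides \<open>v\<close>. So \<open>m\<close> is a perfect
  matching between the two neighbourhoods, and an enumeration of the neighbours of \<open>u\<close>, together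
  with its image under \<open>m\<close>, is an isomorphism from \<open>H\<^sub>d\<close>.
\<close>

lemma extremal_digraph_iso_H_graph:
  assumes conn: "connected (with_proj G)" and eq: "algebraic_connectivity G = real d - 1"
  shows "digraph_iso (with_proj G) (with_proj (H_graph d))"
proof -
  interpret s: regular_remote_pair G d v u by (rule swap)
  interpret H: pair_graph "H_graph d" by (rule pair_graph_H_graph)
  have "\<forall>x\<in>nbrs G u. \<exists>y. y \<in> nbrs G v \<and> nbrs G x = insert u (nbrs G v - {y})"
    using extremal_missing_nbr[OF conn eq] by blast
  from bchoice[OF this] obtain m where m_all:
    "\<forall>x\<in>nbrs G u. m x \<in> nbrs G v \<and> nbrs G x = insert u (nbrs G v - {m x})" ..
  then have m: "m x \<in> nbrs G v" and nm: "nbrs G x = insert u (nbrs G v - {m x})"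
    if "x \<in> nbrs G u" for x
    using that by (blast, metis)
  have inj_m: "inj_on m (nbrs G u)"
  proof (rule inj_onI, rule ccontr)
    fix x y assume xy: "x \<in> nbrs G u" "y \<in> nbrs G u" "m x = m y" "x \<noteq> y"
    have z: "m x \<in> nbrs G v" "m x \<in> pverts G" using m xy(1) in_arcsD2 by auto
    have "m x \<noteq> u" using z(1) nadj arcs_symmetric by blast
    then have "(m x, x) \<notin> parcs G" "(m x, y) \<notin> parcs G"
      using nm[OF xy(1)] nm[OF xy(2)] xy(3) arcs_symmetric by blast+
    then have "nbrs G (m x) \<subseteq> insert v (nbrs G u - {x, y})"
      using s.extremal_nbrs[OF conn eq z(1)] by blast
    then have "card (nbrs G (m x)) \<le> card (insert v (nbrs G u - {x, y}))"
      using finite_nbrs by (intro card_mono) auto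
    also have "\<dots> \<le> Suc (card (nbrs G u - {x, y}))" by (rule card_insert_le_m1) auto
    also have "card (nbrs G u - {x, y}) = d - 2"
      using xy card_nbrs[OF u] finite_nbrs by (subst card_Diff_subset) auto
    finally show False using card_nbrs[OF z(2)] d by simp
  qed
  have "m ` nbrs G u = nbrs G v"
    using m card_image[OF inj_m] card_nbrs[OF u] card_nbrs[OF v] finite_nbrs
    by (intro card_subset_eq) auto
  with inj_m have bij_m: "bij_betw m (nbrs G u) (nbrs G v)" by (simp add: bij_betw_def)
  obtain g where bij_g: "bij_betw g {..<d} (nbrs G u)"
    using ex_bij_betw_nat_finite[OF finite_nbrs[of u]] card_nbrs[OF u] by (auto simp: lessThan_atLeast0)
  define h where "h = m \<circ> g"
  have bij_h: "bij_betw h {..<d} (nbrs G v)"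
    unfolding h_def using bij_g bij_m by (rule bij_betw_trans)
  have gd: "g ` {..<d} = nbrs G u" and hd: "h ` {..<d} = nbrs G v"
    using bij_g bij_h by (simp_all add: bij_betw_def)
  have inj: "inj_on g {..<d}" "inj_on h {..<d}" using bij_g bij_h by (simp_all add: bij_betw_def)
  have gi: "g i \<in> nbrs G u" and hi: "h i \<in> nbrs G v" if "i < d" for i
    using that gd hd by auto
  have hdiff: "nbrs G v - {h i} = h ` ({..<d} - {i})"
    and gdiff: "nbrs G u - {g i} = g ` ({..<d} - {i})" if "i < d" for i
    using that inj unfolding gd[symmetric] hd[symmetric]
    by (simp_all add: inj_on_image_set_diff[where C="{..<d}"])
  have ng: "nbrs G (g i) = insert u (h ` ({..<d} - {i}))" if "i < d" for i
    using nm[OF gi[OF that]] hdiff[OF that] by (simp add: h_def)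
  have nh: "nbrs G (h i) = insert v (g ` ({..<d} - {i}))" if "i < d" for i
  proof -
    have "g j \<in> nbrs G (h i) \<longleftrightarrow> j \<noteq> i" if "j < d" for j
    proof -
      have "h i \<noteq> u" using hi[OF \<open>i < d\<close>] nadj arcs_symmetric by blast
      have "g j \<in> nbrs G (h i) \<longleftrightarrow> h i \<in> nbrs G (g j)" using arcs_symmetric by blast
      also have "\<dots> \<longleftrightarrow> h i \<in> h ` ({..<d} - {j})" using ng[OF that] \<open>h i \<noteq> u\<close> by simp
      also have "\<dots> \<longleftrightarrow> j \<noteq> i" using inj(2) that \<open>i < d\<close> by (auto simp: inj_on_def)
      finally show ?thesis .
    qed
    moreover have "v \<in> nbrs G (h i)" using hi[OF that] arcs_symmetric by blast
    moreover have "nbrs G (h i) \<subseteq> insert v (g ` {..<d})"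
      using s.extremal_nbrs[OF conn eq hi[OF that]] gd by simp
    ultimately show ?thesis by blast
  qed
  define \<phi> where "\<phi> = case_H_vertex g h u v"
  have \<phi>: "\<phi> (Part1 i) = g i" "\<phi> (Part2 i) = h i" "\<phi> Apex1 = u" "\<phi> Apex2 = v" for i
    by (simp_all add: \<phi>_def)
  have dis: "u \<notin> nbrs G u" "u \<notin> nbrs G v" "v \<notin> nbrs G u" "v \<notin> nbrs G v"
    using no_loops' nadj arcs_symmetric by blast+
  have "inj_on \<phi> (pverts (H_graph d))"
    unfolding pverts_H_graph
  proof (rule inj_onI)
    fix x y assume "x \<in> Part1 ` {..<d} \<union> Part2 ` {..<d} \<union> {Apex1, Apex2}"
      "y \<in> Part1 ` {..<d} \<union> Part2 ` {..<d} \<union> {Apex1, Apex2}" and eq: "\<phi> x = \<phi> y"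
    then show "x = y"
      using inj dis gi hi disj neq
      by (elim UnE imageE insertE emptyE; clarsimp simp: \<phi> inj_on_eq_iff; (metis disjoint_iff)?)
  qed
  moreover have "\<phi> ` pverts (H_graph d) = pverts G"
    by (auto simp: extremal_pverts[OF conn eq] pverts_H_graph image_Un image_image \<phi> gd hd
        simp del: Image_singleton_iff)
  ultimately have "bij_betw \<phi> (pverts (H_graph d)) (pverts G)" by (simp add: bij_betw_def)
  moreover have "nbrs G (\<phi> x) = \<phi> ` nbrs (H_graph d) x" if "x \<in> pverts (H_graph d)" for x
    using that unfolding pverts_H_graph
    by (elim UnE imageE insertE emptyE)
      (simp_all add: nbrs_H_graph \<phi> image_image ng nh gd hd del: Image_singleton)
  moreover have "parcs G \<subseteq> pverts G \<times> pverts G" using in_arcsD1 in_arcsD2 by auto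
  ultimately have "digraph_iso (with_proj (H_graph d)) (with_proj G)"
    by (intro H.digraph_isoI_nbrs)
  then show ?thesis by (rule digraph_iso_swap[OF H.wf_digraph])
qed

end

theorem mainTheorem5:
  fixes d :: nat
  assumes "d \<ge> 2"
  shows
    "pair_graph (H_graph d) \<and> connected (with_proj (H_graph d)) \<and> card (pverts (H_graph d)) = 2 * d + 2 \<and>
     regular d (H_graph d) \<and> diameter (H_graph d) = 3 \<and>
     eigenvalue_mset (adjacency_matrix (H_graph d)) =
       {# real d, - real d #} + replicate_mset d 1 + replicate_mset d (- 1) \<and>
     algebraic_connectivity (H_graph d) = real d - 1 \<and>
     (\<forall>G :: 'a pair_pre_digraph.
        pair_graph G \<and> connected (with_proj G) \<and> regular d G \<and> diameter G = 3
          \<longrightarrow> algebraic_connectivity G \<le> real d - 1) \<and>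
     (\<forall>G :: 'a pair_pre_digraph.
        pair_graph G \<and> connected (with_proj G) \<and> regular d G \<and> diameter G = 3 \<and>
        algebraic_connectivity G = real d - 1
          \<longrightarrow> digraph_iso (with_proj G) (with_proj (H_graph d)))"
proof (intro conjI allI impI; (elim conjE)?)
  fix G :: "'a pair_pre_digraph"
  assume G: "pair_graph G" "regular d G" "diameter G = 3" and conn: "connected (with_proj G)"
  obtain u v where "regular_remote_pair G d u v"
    using pair_graph.diameter_three_remote_pair[OF G assms] .
  then interpret regular_remote_pair G d u v .
  show "algebraic_connectivity G \<le> real d - 1" by (rule algebraic_connectivity_le_degree[OF conn])
  assume "algebraic_connectivity G = real d - 1"
  then show "digraph_iso (with_proj G) (with_proj (H_graph d))"
    by (rule extremal_digraph_iso_H_graph[OF conn])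
qed (rule pair_graph_H_graph connected_H_graph[OF assms] card_pverts_H_graph regular_H_graph
    diameter_H_graph[OF assms] eigenvalue_mset_adjacency_H_graph
    algebraic_connectivity_H_graph[OF assms])+

end
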